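(* Let $G$ be a non-trivial metrizable arc-connected topological group, and let $X,Y$ be $t_G$-equivalent infinite Tychonoff spaces. Then: (a) Player II has a winning strategy in $G_{fin}(\Omega(X),\Omega(X))$ if and only if Player II has a winning strategy in $G_{fin}(\Omega(Y),\Omega(Y))$. (b) Player II has a winning strategy in $G_{1}(\Omega(X),\Omega(X))$ if and only if Player II has a winning strategy in $G_{1}(\Omega(Y),\Omega(Y))$.
   Context: Tychonoff means completely regular Hausdorff. A topological group $G$ is arc-connected if any two distinct points of $G$ are joined by a topological embedding $[0,1]\hookrightarrow G$. $C_p(X,G)$ is the space of all continuous functions $X\to G$ with the topology of pointwise convergence. Two spaces $X$ and $Y$ are $t_G$-equivalent if $C_p(X,G)$ and $C_p(Y,G)$ are homeomorphic as topological spaces. An open cover $\mathcal{U}$ of a space $Z$ is an $\omega$-cover if $Z\notin\mathcal{U}$ and every finite subset of $Z$ is contained in some member of $\mathcal{U}$; $\Omega(Z)$ is the collection of all $\omega$-covers of $Z$. For collections $\mathcal{A},\mathcal{B}$ of subsets of an infinite set, the game $G_{fin}(\mathcal{A},\mathcal{B})$ is played in innings $n\in\mathbb{N}=\{1,2,\dots\}$: in inning $n$ Player I selects $A_n\in\mathcal{A}$ and Player II responds with a finite subset $B_n\subset A_n$; Player II wins if $\bigcup_n B_n\in\mathcal{B}$, otherwise Player I wins. The game $G_1(\mathcal{A},\mathcal{B})$ is the same except that Player II responds with a single element $b_n\in A_n$, and Player II wins if $\{b_n:n\in\mathbb{N}\}\in\mathcal{B}$. A strategy for Player II is a function $\sigma$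 on $\bigcup_{n\ge1}\mathcal{A}^n$ assigning to each $(A_1,\dots,A_n)$ a legal response to $A_n$ (a finite subset of $A_n$, respectively an element of $A_n$); it is winning if, for every sequence $(A_n)_n$ of elements of $\mathcal{A}$ played by Player I, Player II wins by responding with $\sigma(A_1,\dots,A_n)$ in each inning $n$. *)

theory Defs
  imports "HOL-Analysis.Analysis"
begin

definition tychonoff_space :: "'a topology \<Rightarrow> bool" where
  "tychonoff_space X \<longleftrightarrow> completely_regular_space X \<and> Hausdorff_space X"

definition arc_connected_space :: "'a topology \<Rightarrow> bool" where
  "arc_connected_space X \<longleftrightarrow>
     (\<forall>x\<in>topspace X. \<forall>y\<in>topspace X. x \<noteq> y \<longrightarrow>
        (\<exists>f. embedding_map (top_of_set {0..1::real}) X f \<and> f 0 = x \<and> f 1 = y))"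

(* Functions are taken to be extensional (undefined outside the space), as in the
   carrier of a product topology, so that each continuous function on the space
   corresponds to exactly one point. *)
definition Cp :: "'a topology \<Rightarrow> 'g topology \<Rightarrow> ('a \<Rightarrow> 'g) topology" where
  "Cp X T = subtopology (product_topology (\<lambda>_. T) (topspace X))
              {f \<in> extensional (topspace X). continuous_map X T f}"

definition t_equivalent :: "'g topology \<Rightarrow> 'a topology \<Rightarrow> 'b topology \<Rightarrow> bool" where
  "t_equivalent T X Y \<longleftrightarrow> Cp X T homeomorphic_space Cp Y T"

definition omega_cover :: "'a topology \<Rightarrow> 'a set set \<Rightarrow> bool" where
  "omega_cover X \<U> \<longleftrightarrow>
     (\<forall>U\<in>\<U>. openin X U) \<and> \<Union>\<U> = topspace X \<and> topspace X \<notin> \<U> \<and>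
     (\<forall>F. finite F \<and> F \<subseteq> topspace X \<longrightarrow> (\<exists>U\<in>\<U>. F \<subseteq> U))"

definition Omega_covers :: "'a topology \<Rightarrow> 'a set set set" where
  "Omega_covers X = {\<U>. omega_cover X \<U>}"

(* In both games innings are numbered from 0, so the moves of Player I up to and
   including inning n form the list [A 0, ..., A n]. A strategy is a total function
   on lists; only its values on nonempty lists of members of \<A> matter. *)

definition fin_strategy :: "'b set set \<Rightarrow> ('b set list \<Rightarrow> 'b set) \<Rightarrow> bool" where
  "fin_strategy \<A> \<sigma> \<longleftrightarrow>
     (\<forall>As. As \<noteq> [] \<and> set As \<subseteq> \<A> \<longrightarrow> finite (\<sigma> As) \<and> \<sigma> As \<subseteq> last As)"

definition II_wins_Gfin :: "'b set set \<Rightarrow> 'b set set \<Rightarrow> bool" where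
  "II_wins_Gfin \<A> \<B> \<longleftrightarrow>
     (\<exists>\<sigma>. fin_strategy \<A> \<sigma> \<and>
        (\<forall>A :: nat \<Rightarrow> 'b set. (\<forall>n. A n \<in> \<A>) \<longrightarrow> (\<Union>n. \<sigma> (map A [0..<Suc n])) \<in> \<B>))"

definition one_strategy :: "'b set set \<Rightarrow> ('b set list \<Rightarrow> 'b) \<Rightarrow> bool" where
  "one_strategy \<A> \<sigma> \<longleftrightarrow>
     (\<forall>As. As \<noteq> [] \<and> set As \<subseteq> \<A> \<longrightarrow> \<sigma> As \<in> last As)"

definition II_wins_G1 :: "'b set set \<Rightarrow> 'b set set \<Rightarrow> bool" where
  "II_wins_G1 \<A> \<B> \<longleftrightarrow>
     (\<exists>\<sigma>. one_strategy \<A> \<sigma> \<and>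
        (\<forall>A :: nat \<Rightarrow> 'b set. (\<forall>n. A n \<in> \<A>) \<longrightarrow> range (\<lambda>n. \<sigma> (map A [0..<Suc n])) \<in> \<B>))"

end

theory Submission
  imports Defs
begin

text \<open>
  Both games on the \<open>\<omega>\<close>-covers of \<open>X\<close> are equivalent to the same games on the sets
  \<open>A\<close> that accumulate at a fixed point \<open>p\<close> of \<open>C\<^sub>p(X,G)\<close>, and these are
  invariant under homeomorphisms. If \<open>A\<close> accumulates at \<open>p\<close> and \<open>V\<^sub>0, V\<^sub>1, \<dots>\<close>
  shrink to \<open>0\<close> in \<open>G\<close>, then the sets \<open>{y. f y - p y \<in> V\<^sub>n} - {x}\<close> with
  \<open>f \<in> A\<close> form an \<open>\<omega>\<close>-cover; removing \<open>x\<close> avoids the degenerate case in which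
  \<open>f\<close> is uniformly close to \<open>p\<close>. Conversely, for an \<open>\<omega>\<close>-cover \<open>\<U>\<close> and
  \<open>g \<noteq> 0\<close>, the set of all \<open>f\<close> that equal \<open>g + p\<close> off some member of \<open>\<U>\<close>
  accumulates at \<open>p\<close>, by complete regularity of \<open>X\<close> and a path from \<open>0\<close> to
  \<open>g\<close>; and \<open>f\<close> can be close to \<open>p\<close> on a finite set only if that member contains it.
\<close>

section \<open>Carrying winning strategies from one game to another\<close>

text \<open>Player II keeps an auxiliary play of the game on \<open>\<A>\<close>: a move
  \<open>A\<close> of inning \<open>n\<close> is passed on as \<open>\<Phi> n A\<close>, and the
  answers of the given strategy are carried back by \<open>\<psi> n A\<close>. The maps may depend
  on the inning, which allows neighbourhoods that shrink during the play. A single hypothesis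
  \<open>win\<close> serves both games, since a play with single responses is one with singletons
  \<open>B n\<close>.\<close>

lemma game_transfer:
  fixes \<A> \<B> :: "'b set set" and \<A>' \<B>' :: "'c set set"
  assumes \<Phi>: "\<And>(n::nat) A. A \<in> \<A>' \<Longrightarrow> \<Phi> n A \<in> \<A>"
    and \<psi>: "\<And>n A b. \<lbrakk>A \<in> \<A>'; b \<in> \<Phi> n A\<rbrakk> \<Longrightarrow> \<psi> n A b \<in> A"
    and win: "\<And>A B. \<lbrakk>\<And>n. A n \<in> \<A>'; \<And>n. finite (B n); \<And>n. B n \<subseteq> \<Phi> n (A n); (\<Union>n. B n) \<in> \<B>\<rbrakk>
                \<Longrightarrow> (\<Union>n. \<psi> n (A n) ` B n) \<in> \<B>'"
  shows "(II_wins_Gfin \<A> \<B> \<longrightarrow> II_wins_Gfin \<A>' \<B>') \<and> (II_wins_G1 \<A> \<B> \<longrightarrow> II_wins_G1 \<A>' \<B>')"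
proof -
  \<comment> \<open>The whole history is translated, position \<open>i\<close> with the map of
    inning \<open>i\<close>. Innings start at 0, so a history \<open>As\<close> ends in inning
    \<open>length As - 1\<close>.\<close>
  define tr where "tr As = map (\<lambda>i. \<Phi> i (As ! i)) [0..<length As]" for As
  have tr_map: "tr (map A [0..<n]) = map (\<lambda>i. \<Phi> i (A i)) [0..<n]" for A n
    by (simp add: tr_def)
  have tr: "tr As \<noteq> [] \<and> set (tr As) \<subseteq> \<A> \<and> last (tr As) = \<Phi> (length As - 1) (last As) \<and> last As \<in> \<A>'"
    if "As \<noteq> []" "set As \<subseteq> \<A>'" for As
  proof -
    have "As ! i \<in> \<A>'" if "i < length As" for i
      using that \<open>set As \<subseteq> \<A>'\<close> nth_mem by blast
    then have "set (tr As) \<subseteq> \<A>"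
      using \<Phi> by (auto simp: tr_def)
    moreover have "last (tr As) = \<Phi> (length As - 1) (last As)"
      using \<open>As \<noteq> []\<close> by (simp add: tr_def last_map last_conv_nth)
    moreover have "last As \<in> \<A>'"
      using that by auto
    ultimately show ?thesis
      using \<open>As \<noteq> []\<close> by (simp add: tr_def)
  qed
  have "II_wins_Gfin \<A>' \<B>'" if wins: "II_wins_Gfin \<A> \<B>"
  proof -
    obtain \<sigma> where \<sigma>: "fin_strategy \<A> \<sigma>"
      and \<sigma>_wins: "\<forall>A. (\<forall>n. A n \<in> \<A>) \<longrightarrow> (\<Union>n. \<sigma> (map A [0..<Suc n])) \<in> \<B>"
      using wins unfolding II_wins_Gfin_def by blast
    define \<sigma>' where "\<sigma>' As = \<psi> (length As - 1) (last As) ` \<sigma> (tr As)" for As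
    have \<sigma>_tr: "finite (\<sigma> (tr As)) \<and> \<sigma> (tr As) \<subseteq> \<Phi> (length As - 1) (last As)"
      if "As \<noteq> []" "set As \<subseteq> \<A>'" for As
      using \<sigma> tr[OF that] unfolding fin_strategy_def by metis
    have "fin_strategy \<A>' \<sigma>'"
      unfolding fin_strategy_def
    proof (intro allI impI)
      fix As assume "As \<noteq> [] \<and> set As \<subseteq> \<A>'"
      then show "finite (\<sigma>' As) \<and> \<sigma>' As \<subseteq> last As"
        using \<sigma>_tr[of As] tr[of As] \<psi> unfolding \<sigma>'_def by blast
    qed
    moreover have "(\<Union>n. \<sigma>' (map A [0..<Suc n])) \<in> \<B>'" if A: "\<forall>n. A n \<in> \<A>'" for A
    proof -
      define B where "B n = \<sigma> (map (\<lambda>i. \<Phi> i (A i)) [0..<Suc n])" for n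
      have "\<sigma>' (map A [0..<Suc n]) = \<psi> n (A n) ` B n" for n
        unfolding \<sigma>'_def B_def tr_map by simp
      moreover have "finite (B n) \<and> B n \<subseteq> \<Phi> n (A n)" for n
        using \<sigma>_tr[of "map A [0..<Suc n]"] A unfolding B_def tr_map by auto
      moreover have "(\<Union>n. B n) \<in> \<B>"
        unfolding B_def using A \<Phi> by (intro \<sigma>_wins[rule_format]) blast
      ultimately show ?thesis
        using win[of A B] A by simp
    qed
    ultimately show ?thesis
      unfolding II_wins_Gfin_def by blast
  qed
  moreover have "II_wins_G1 \<A>' \<B>'" if wins: "II_wins_G1 \<A> \<B>"
  proof -
    obtain \<sigma> where \<sigma>: "one_strategy \<A> \<sigma>"
      and \<sigma>_wins: "\<forall>A. (\<forall>n. A n \<in> \<A>) \<longrightarrow> range (\<lambda>n. \<sigma> (map A [0..<Suc n])) \<in> \<B>"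
      using wins unfolding II_wins_G1_def by blast
    define \<sigma>' where "\<sigma>' As = \<psi> (length As - 1) (last As) (\<sigma> (tr As))" for As
    have \<sigma>_tr: "\<sigma> (tr As) \<in> \<Phi> (length As - 1) (last As)"
      if "As \<noteq> []" "set As \<subseteq> \<A>'" for As
      using \<sigma> tr[OF that] unfolding one_strategy_def by metis
    have "one_strategy \<A>' \<sigma>'"
      unfolding one_strategy_def
    proof (intro allI impI)
      fix As assume "As \<noteq> [] \<and> set As \<subseteq> \<A>'"
      then show "\<sigma>' As \<in> last As"
        using \<sigma>_tr[of As] tr[of As] \<psi> unfolding \<sigma>'_def by blast
    qed
    moreover have "range (\<lambda>n. \<sigma>' (map A [0..<Suc n])) \<in> \<B>'" if A: "\<forall>n. A n \<in> \<A>'" for A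
    proof -
      define b where "b n = \<sigma> (map (\<lambda>i. \<Phi> i (A i)) [0..<Suc n])" for n
      have "\<sigma>' (map A [0..<Suc n]) = \<psi> n (A n) (b n)" for n
        unfolding \<sigma>'_def b_def tr_map by simp
      then have "range (\<lambda>n. \<sigma>' (map A [0..<Suc n])) = (\<Union>n. \<psi> n (A n) ` {b n})"
        by auto
      moreover have "b n \<in> \<Phi> n (A n)" for n
        using \<sigma>_tr[of "map A [0..<Suc n]"] A unfolding b_def tr_map by auto
      moreover have "range b \<in> \<B>"
        unfolding b_def using A \<Phi> by (intro \<sigma>_wins[rule_format]) blast
      then have "(\<Union>n. {b n}) \<in> \<B>"
        by (simp add: UNION_singleton_eq_range)
      ultimately show ?thesis
        using win[of A "\<lambda>n. {b n}"] A by simp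
    qed
    ultimately show ?thesis
      unfolding II_wins_G1_def by blast
  qed
  ultimately show ?thesis
    by blast
qed

section \<open>Accumulation games and their invariance under homeomorphisms\<close>

text \<open>The family usually written \<open>Omega_p\<close>; the games on it are the game forms of
  countable fan tightness (finite selections) and of countable strong fan tightness (single
  selections) at \<open>p\<close>.\<close>

definition accumulating_sets :: "'z topology \<Rightarrow> 'z \<Rightarrow> 'z set set" where
  "accumulating_sets Z p = {A. A \<subseteq> topspace Z \<and> p \<notin> A \<and> p \<in> Z closure_of A}"

lemma accumulating_sets_homeomorphic_image:
  assumes "homeomorphic_map Z Z' f" "p \<in> topspace Z" "A \<in> accumulating_sets Z p"
  shows "f ` A \<in> accumulating_sets Z' (f p)"
proof -
  have A: "A \<subseteq> topspace Z" "p \<notin> A" "p \<in> Z closure_of A"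
    using assms(3) by (auto simp: accumulating_sets_def)
  have f: "inj_on f (topspace Z)" "f ` topspace Z = topspace Z'"
    using assms(1) by (auto simp: homeomorphic_eq_everything_map)
  have "f p \<notin> f ` A"
    using A f(1) assms(2) by (auto dest: inj_onD)
  moreover have "f p \<in> Z' closure_of (f ` A)"
    using A homeomorphic_map_closure_of[OF assms(1) A(1)] by blast
  ultimately show ?thesis
    using A(1) f(2) by (auto simp: accumulating_sets_def)
qed

text \<open>Moves are pulled back along \<open>k\<close> and responses pushed forward along
  \<open>f\<close>. The base point travels to \<open>f p\<close>, over which there is no control;
  hence the comparison with covers is made at an arbitrary point of the function space.\<close>

lemma accumulation_games_homeomorphic:
  assumes "homeomorphic_maps Z Z' f k" and p: "p \<in> topspace Z"
  shows "(II_wins_Gfin (accumulating_sets Z p) (accumulating_sets Z p) \<longrightarrow>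
            II_wins_Gfin (accumulating_sets Z' (f p)) (accumulating_sets Z' (f p))) \<and>
         (II_wins_G1 (accumulating_sets Z p) (accumulating_sets Z p) \<longrightarrow>
            II_wins_G1 (accumulating_sets Z' (f p)) (accumulating_sets Z' (f p)))"
proof (rule game_transfer[where \<Phi> = "\<lambda>n A. k ` A" and \<psi> = "\<lambda>n A. f"])
  have f: "homeomorphic_map Z Z' f" and k: "homeomorphic_map Z' Z k"
    and kf: "k (f p) = p" and fk: "\<And>z. z \<in> topspace Z' \<Longrightarrow> f (k z) = z"
    using assms by (auto simp: homeomorphic_maps_map)
  have fp: "f p \<in> topspace Z'"
    using f p homeomorphic_imp_surjective_map by blast
  show "k ` A \<in> accumulating_sets Z p" if "A \<in> accumulating_sets Z' (f p)" for A
    using accumulating_sets_homeomorphic_image[OF k fp that] kf by simp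
  show "f b \<in> A" if "A \<in> accumulating_sets Z' (f p)" "b \<in> k ` A" for A b
    using that fk by (auto simp: accumulating_sets_def subset_iff)
  show "(\<Union>n. f ` B n) \<in> accumulating_sets Z' (f p)"
    if "(\<Union>n. B n) \<in> accumulating_sets Z p" for B :: "nat \<Rightarrow> _"
    using accumulating_sets_homeomorphic_image[OF f p that] by (simp add: image_UN)
qed

section \<open>Basic facts on omega-covers\<close>

text \<open>Openness puts the union of \<open>\<U>\<close> inside the space, and the condition on
  finite sets, applied to singletons, gives the reverse inclusion.\<close>

lemma Omega_covers_iff:
  "\<U> \<in> Omega_covers X \<longleftrightarrow>
     (\<forall>U\<in>\<U>. openin X U) \<and> topspace X \<notin> \<U> \<and>
     (\<forall>F. finite F \<longrightarrow> F \<subseteq> topspace X \<longrightarrow> (\<exists>U\<in>\<U>. F \<subseteq> U))"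
proof -
  have "\<Union>\<U> = topspace X"
    if "\<forall>U\<in>\<U>. openin X U" "\<forall>F. finite F \<longrightarrow> F \<subseteq> topspace X \<longrightarrow> (\<exists>U\<in>\<U>. F \<subseteq> U)"
  proof
    show "\<Union>\<U> \<subseteq> topspace X"
      using that(1) openin_subset by blast
    show "topspace X \<subseteq> \<Union>\<U>"
    proof
      fix x assume "x \<in> topspace X"
      then show "x \<in> \<Union>\<U>"
        using that(2)[rule_format, of "{x}"] by auto
    qed
  qed
  then show ?thesis
    unfolding Omega_covers_def omega_cover_def mem_Collect_eq imp_conjL by argo
qed

text \<open>Adding to \<open>F\<close> a point outside each of the finitely many sets to be avoided.\<close>

lemma Omega_covers_avoid:
  assumes \<U>: "\<U> \<in> Omega_covers X" and "finite \<V>" "\<V> \<subseteq> \<U>" and "finite F" "F \<subseteq> topspace X"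
  obtains U where "U \<in> \<U>" "U \<notin> \<V>" "F \<subseteq> U"
proof -
  have "\<exists>x. x \<in> topspace X \<and> x \<notin> V" if "V \<in> \<V>" for V
    using that \<U> \<open>\<V> \<subseteq> \<U>\<close> openin_subset unfolding Omega_covers_iff
    by (metis subsetD subsetI subset_antisym)
  then obtain x where x: "\<And>V. V \<in> \<V> \<Longrightarrow> x V \<in> topspace X \<and> x V \<notin> V"
    by metis
  have "finite (F \<union> x ` \<V>)" "F \<union> x ` \<V> \<subseteq> topspace X"
    using assms x by auto
  then obtain U where "U \<in> \<U>" "F \<union> x ` \<V> \<subseteq> U"
    using \<U> unfolding Omega_covers_iff by meson
  then show thesis
    using that x by blast
qed

section \<open>Closures in the function space and neighbourhoods in the group\<close>

lemma topspace_Cp: "topspace (Cp X T) = {f \<in> extensional (topspace X). continuous_map X T f}"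
  unfolding Cp_def by (auto simp: PiE_def dest: continuous_map_funspace)

lemma openin_translate:
  fixes W :: "'g :: topological_group_add set"
  assumes "open W"
  shows "open {z. z - c \<in> W}" "open {z. z + c \<in> W}"
proof -
  have "continuous_on UNIV (\<lambda>z. z - c)" "continuous_on UNIV (\<lambda>z. z + c)"
    unfolding continuous_on_def by (auto intro!: tendsto_intros)
  then show "open {z. z - c \<in> W}" "open {z. z + c \<in> W}"
    using open_vimage[OF assms] by (auto simp: vimage_def)
qed

text \<open>The functions \<open>f\<close> with \<open>f x - p x \<in> V\<close> for all
  \<open>x \<in> F\<close> form a neighbourhood base at \<open>p\<close>: translations turn
  neighbourhoods of the values \<open>p x\<close> into neighbourhoods of 0, and finitely many of
  these have a common one.\<close>

lemma in_Cp_closure_of_iff: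
  fixes p :: "'a \<Rightarrow> 'g :: topological_group_add"
  assumes p: "p \<in> topspace (Cp X euclidean)" and A: "A \<subseteq> topspace (Cp X euclidean)"
  shows "p \<in> Cp X euclidean closure_of A \<longleftrightarrow>
    (\<forall>F V. finite F \<longrightarrow> F \<subseteq> topspace X \<longrightarrow> open V \<longrightarrow> 0 \<in> V \<longrightarrow> (\<exists>f\<in>A. \<forall>x\<in>F. f x - p x \<in> V))"
    (is "?lhs \<longleftrightarrow> ?rhs")
proof
  assume L: ?lhs
  show ?rhs
  proof (intro allI impI)
    fix F and V :: "'g set"
    assume F: "finite F" "F \<subseteq> topspace X" and V: "open V" "0 \<in> V"
    let ?W = "\<lambda>x. {f \<in> topspace (Cp X euclidean). f x \<in> {z. z - p x \<in> V}}"
    have "openin (Cp X euclidean) (?W x)" if "x \<in> F" for x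
    proof (rule openin_continuous_map_preimage[where Y = euclidean])
      show "continuous_map (Cp X euclidean) euclidean (\<lambda>f. f x)"
        unfolding Cp_def using that F(2)
        by (intro continuous_map_from_subtopology continuous_map_product_projection) auto
      show "openin euclidean {z. z - p x \<in> V}"
        using openin_translate(1)[OF V(1)] by simp
    qed
    \<comment> \<open>The factor \<open>topspace\<close> takes care of empty \<open>F\<close>, for
      which the indexed intersection is the whole type.\<close>
    then have "openin (Cp X euclidean) (topspace (Cp X euclidean) \<inter> (\<Inter>x\<in>F. ?W x))"
      using F(1) by (cases "F = {}") auto
    moreover have "p \<in> topspace (Cp X euclidean) \<inter> (\<Inter>x\<in>F. ?W x)"
      using p V(2) by simp
    ultimately obtain f where "f \<in> A" "f \<in> topspace (Cp X euclidean) \<inter> (\<Inter>x\<in>F. ?W x)"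
      using L unfolding in_closure_of by meson
    then show "\<exists>f\<in>A. \<forall>x\<in>F. f x - p x \<in> V"
      by auto
  qed
next
  assume R: ?rhs
  show ?lhs
    unfolding in_closure_of
  proof (intro conjI allI impI p)
    fix T assume "p \<in> T \<and> openin (Cp X euclidean) T"
    then obtain S where "openin (product_topology (\<lambda>_. euclidean) (topspace X)) S" "p \<in> S"
      and S: "S \<inter> topspace (Cp X euclidean) \<subseteq> T"
      unfolding topspace_Cp by (auto simp: Cp_def openin_subtopology)
    then obtain U where fin: "finite {i \<in> topspace X. U i \<noteq> (UNIV :: 'g set)}"
      and U: "\<And>i. i \<in> topspace X \<Longrightarrow> open (U i)" "p \<in> Pi\<^sub>E (topspace X) U" "Pi\<^sub>E (topspace X) U \<subseteq> S"
      unfolding openin_product_topology_alt by fastforce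
    define F where "F = {i \<in> topspace X. U i \<noteq> UNIV}"
    have F: "finite F" "F \<subseteq> topspace X"
      using fin by (auto simp: F_def)
    \<comment> \<open>Each \<open>U i\<close> restricting a coordinate is moved from
      \<open>p i\<close> to 0, so that one neighbourhood \<open>V\<close> serves all coordinates in
      \<open>F\<close>.\<close>
    define V where "V = (\<Inter>i\<in>F. {z. z + p i \<in> U i})"
    have "open V"
      unfolding V_def using F U(1) openin_translate(2) by (intro open_INT) auto
    moreover have "0 \<in> V"
      using U(2) F(2) by (auto simp: V_def)
    ultimately obtain f where f: "f \<in> A" "\<And>x. x \<in> F \<Longrightarrow> f x - p x \<in> V"
      using R F by meson
    have "f x \<in> U x" if "x \<in> topspace X" for x
    proof (cases "x \<in> F")
      case True
      then have "f x - p x + p x \<in> U x"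
        using f(2) unfolding V_def by blast
      then show ?thesis by simp
    next
      case False
      then show ?thesis
        using that by (auto simp: F_def)
    qed
    moreover have "f \<in> extensional (topspace X)"
      using f(1) A unfolding topspace_Cp by blast
    ultimately have "f \<in> S"
      using U(3) by (auto simp: PiE_def)
    then show "\<exists>y. y \<in> A \<and> y \<in> T"
      using f(1) A S by blast
  qed
qed

text \<open>Balls of radius \<open>1/(n+1)\<close>. The inclusion is claimed for all late
  \<open>n\<close>, because the inning in which Player II makes a useful selection is known only to
  be late.\<close>

lemma metrizable_nbhd_sequence:
  fixes a :: "'g :: topological_space"
  assumes "metrizable_space (euclidean :: 'g topology)"
  obtains V :: "nat \<Rightarrow> 'g set"
  where "\<And>n. open (V n)" "\<And>n. a \<in> V n" "\<And>W. \<lbrakk>open W; a \<in> W\<rbrakk> \<Longrightarrow> \<exists>N. \<forall>n\<ge>N. V n \<subseteq> W"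
proof -
  obtain M d where "Metric_space M d" and eq: "(euclidean :: 'g topology) = Metric_space.mtopology M d"
    using assms unfolding metrizable_space_def by blast
  then interpret Metric_space M d
    by simp
  have M: "M = UNIV"
    using eq topspace_mtopology by (metis topspace_euclidean)
  have op: "open W \<longleftrightarrow> openin mtopology W" for W
    using eq by (metis open_openin)
  show thesis
  proof (rule that[of "\<lambda>n. mball a (inverse (real (Suc n)))"])
    show "open (mball a (inverse (real (Suc n))))" for n
      unfolding op by simp
    show "a \<in> mball a (inverse (real (Suc n)))" for n
      by (intro centre_in_mball_iff[THEN iffD2]) (auto simp: M)
    fix W assume "open W" "a \<in> W"
    then obtain r where "r > 0" "mball a r \<subseteq> W"
      unfolding op openin_mtopology by blast
    moreover obtain N where "inverse (real (Suc N)) < r"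
      using reals_Archimedean \<open>r > 0\<close> by blast
    moreover have "inverse (real (Suc n)) \<le> inverse (real (Suc N))" if "N \<le> n" for n
      using that by (intro le_imp_inverse_le) auto
    ultimately have "mball a (inverse (real (Suc n))) \<subseteq> W" if "N \<le> n" for n
      using that mball_subset_concentric by (meson less_imp_le order_trans subset_trans)
    then show "\<exists>N. \<forall>n\<ge>N. mball a (inverse (real (Suc n))) \<subseteq> W"
      by blast
  qed
qed

lemma continuous_map_diff_group:
  fixes f g :: "'a \<Rightarrow> 'g :: topological_group_add"
  assumes "continuous_map X euclidean f" "continuous_map X euclidean g"
  shows "continuous_map X euclidean (\<lambda>x. f x - g x)"
  using assms unfolding continuous_map_atin by (auto intro!: tendsto_diff)

section \<open>From omega-covers of the space to accumulation in the function space\<close>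

text \<open>A set selected in inning \<open>n\<close> controls its function only up to
  \<open>V n\<close>. An omega-cover survives the removal of finitely many members, so every finite
  set lies in a member first selected after any prescribed inning, where \<open>V n\<close> is as
  small as desired.\<close>

lemma cover_games_imp_accumulation_games:
  fixes X :: "'a topology" and p :: "'a \<Rightarrow> 'g :: topological_group_add"
  assumes met: "metrizable_space (euclidean :: 'g topology)"
    and t1: "t1_space X" and inf: "infinite (topspace X)"
    and p: "p \<in> topspace (Cp X euclidean)"
  defines "\<Lambda> \<equiv> accumulating_sets (Cp X euclidean) p"
  shows "(II_wins_Gfin (Omega_covers X) (Omega_covers X) \<longrightarrow> II_wins_Gfin \<Lambda> \<Lambda>) \<and>
         (II_wins_G1 (Omega_covers X) (Omega_covers X) \<longrightarrow> II_wins_G1 \<Lambda> \<Lambda>)"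
proof -
  obtain V :: "nat \<Rightarrow> 'g set" where V: "\<And>n. open (V n)" "\<And>n. 0 \<in> V n"
    and V_small: "\<And>W. \<lbrakk>open W; 0 \<in> W\<rbrakk> \<Longrightarrow> \<exists>N. \<forall>n\<ge>N. V n \<subseteq> W"
    using metrizable_nbhd_sequence[OF met, of 0] by blast
  define nb where "nb n f x = {y \<in> topspace X. f y - p y \<in> V n} - {x}" for n x and f :: "'a \<Rightarrow> 'g"
  define \<Phi> where "\<Phi> n A = {nb n f x |f x. f \<in> A \<and> x \<in> topspace X}" for n A
  \<comment> \<open>Different functions may yield the same set \<open>U\<close>, so one that does is
    chosen.\<close>
  define \<psi> where "\<psi> n A U = (SOME f. f \<in> A \<and> (\<exists>x. U = nb n f x))" for n A U
  have \<psi>: "\<psi> n A U \<in> A \<and> (\<exists>x. U = nb n (\<psi> n A U) x)" if "U \<in> \<Phi> n A" for n A U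
  proof -
    have "\<exists>f. f \<in> A \<and> (\<exists>x. U = nb n f x)"
      using that by (auto simp: \<Phi>_def)
    then show ?thesis
      unfolding \<psi>_def by (rule someI_ex)
  qed
  have \<Lambda>: "A \<subseteq> topspace (Cp X euclidean)" "p \<notin> A"
    and close: "\<And>F W. \<lbrakk>finite F; F \<subseteq> topspace X; open W; 0 \<in> W\<rbrakk> \<Longrightarrow> \<exists>f\<in>A. \<forall>x\<in>F. f x - p x \<in> W"
    if "A \<in> \<Lambda>" for A
  proof -
    show *: "A \<subseteq> topspace (Cp X euclidean)" "p \<notin> A"
      using that by (auto simp: \<Lambda>_def accumulating_sets_def)
    have "p \<in> Cp X euclidean closure_of A"
      using that by (auto simp: \<Lambda>_def accumulating_sets_def)
    then show "\<exists>f\<in>A. \<forall>x\<in>F. f x - p x \<in> W"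
      if "finite F" "F \<subseteq> topspace X" "open W" "0 \<in> W" for F W
      using that unfolding in_Cp_closure_of_iff[OF p *(1)] by blast
  qed
  show ?thesis
  proof (rule game_transfer[where \<Phi> = \<Phi> and \<psi> = \<psi>])
    fix n A assume A: "A \<in> \<Lambda>"
    show "\<Phi> n A \<in> Omega_covers X"
      unfolding Omega_covers_iff
    proof (intro conjI ballI allI impI)
      fix U assume "U \<in> \<Phi> n A"
      then obtain f x where f: "f \<in> A" and U: "U = nb n f x"
        by (auto simp: \<Phi>_def)
      have "continuous_map X euclidean (\<lambda>y. f y - p y)"
        using f \<Lambda>[OF A] p by (intro continuous_map_diff_group) (auto simp: topspace_Cp)
      then have "openin X {y \<in> topspace X. f y - p y \<in> V n}"
        by (rule openin_continuous_map_preimage) (use V in simp)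
      then show "openin X U"
        unfolding U nb_def using t1 by (simp add: t1_space_openin_delete_alt)
    next
      show "topspace X \<notin> \<Phi> n A"
        by (auto simp: \<Phi>_def nb_def)
    next
      fix F assume F: "finite F" "F \<subseteq> topspace X"
      then obtain f where f: "f \<in> A" "\<And>x. x \<in> F \<Longrightarrow> f x - p x \<in> V n"
        using close[OF A] V by meson
      \<comment> \<open>As the space is infinite, the deleted point can be taken outside
        \<open>F\<close>, and \<open>nb n f x\<close> still contains \<open>F\<close>.\<close>
      obtain x where "x \<in> topspace X" "x \<notin> F"
        using inf F by (meson finite_subset subsetI)
      then show "\<exists>U\<in>\<Phi> n A. F \<subseteq> U"
        using f F by (intro bexI[of _ "nb n f x"]) (auto simp: nb_def \<Phi>_def)
    qed
  next
    show "\<psi> n A U \<in> A" if "U \<in> \<Phi> n A" for n A U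
      using \<psi>[OF that] by blast
  next
    fix A :: "nat \<Rightarrow> _" and B
    assume A: "\<And>n. A n \<in> \<Lambda>" and B: "\<And>n. finite (B n)" "\<And>n. B n \<subseteq> \<Phi> n (A n)"
      and cover: "(\<Union>n. B n) \<in> Omega_covers X"
    let ?C = "\<Union>n. \<psi> n (A n) ` B n"
    have C_A: "?C \<subseteq> (\<Union>n. A n)"
      using \<psi> B(2) by blast
    then have C: "?C \<subseteq> topspace (Cp X euclidean)" "p \<notin> ?C"
      using \<Lambda>[OF A] by blast+
    have "\<exists>f\<in>?C. \<forall>x\<in>F. f x - p x \<in> W"
      if F: "finite F" "F \<subseteq> topspace X" and W: "open W" "0 \<in> W" for F W
    proof -
      obtain N where N: "\<And>n. N \<le> n \<Longrightarrow> V n \<subseteq> W"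
        using V_small[OF W] by blast
      \<comment> \<open>The selections of the first \<open>N\<close> innings form a finite family. A
        \<open>U\<close> outside it was selected in some inning \<open>n \<ge> N\<close>, where
        \<open>V n \<subseteq> W\<close>.\<close>
      obtain U where "U \<in> (\<Union>n. B n)" "U \<notin> (\<Union>n<N. B n)" and FU: "F \<subseteq> U"
        by (rule Omega_covers_avoid[OF cover _ _ F, of "\<Union>n<N. B n"]) (use B in auto)
      then obtain n where n: "U \<in> B n" "N \<le> n"
        by (metis UN_E UN_I lessThan_iff not_le)
      then obtain x where "U = nb n (\<psi> n (A n) U) x"
        using \<psi> B(2) by blast
      then have "\<forall>x\<in>F. \<psi> n (A n) U x - p x \<in> W"
        using FU N[OF n(2)] unfolding nb_def by blast
      then show ?thesis
        using n by blast
    qed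
    then show "?C \<in> \<Lambda>"
      unfolding \<Lambda>_def accumulating_sets_def
      using C in_Cp_closure_of_iff[OF p C(1)] by blast
  qed
qed

section \<open>From accumulation in the function space to omega-covers of the space\<close>

text \<open>If \<open>f - p\<close> takes the value \<open>\<gamma> 1\<close> off \<open>U\<close>
  and avoids it on \<open>F\<close>, then \<open>F \<subseteq> U\<close>. The complement of
  \<open>\<gamma> 1\<close> is one fixed neighbourhood of 0 that works in all innings, so the
  translation is the same in each of them.\<close>

lemma accumulation_games_imp_cover_games:
  fixes X :: "'a topology" and p :: "'a \<Rightarrow> 'g :: topological_group_add"
  assumes t1: "t1_space (euclidean :: 'g topology)"
    and \<gamma>: "continuous_map (top_of_set {0..1::real}) (euclidean :: 'g topology) \<gamma>" "\<gamma> 0 = 0" "\<gamma> 1 \<noteq> 0"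
    and creg: "completely_regular_space X" and Haus: "Hausdorff_space X"
    and p: "p \<in> topspace (Cp X euclidean)"
  defines "\<Lambda> \<equiv> accumulating_sets (Cp X euclidean) p"
  shows "(II_wins_Gfin \<Lambda> \<Lambda> \<longrightarrow> II_wins_Gfin (Omega_covers X) (Omega_covers X)) \<and>
         (II_wins_G1 \<Lambda> \<Lambda> \<longrightarrow> II_wins_G1 (Omega_covers X) (Omega_covers X))"
proof -
  define off where "off f U \<longleftrightarrow> (\<forall>x\<in>topspace X - U. f x - p x = \<gamma> 1)" for f U
  define \<Phi> where "\<Phi> n \<U> = {f \<in> topspace (Cp X euclidean). \<exists>U\<in>\<U>. off f U}" for n :: nat and \<U>
  define \<psi> where "\<psi> n \<U> f = (SOME U. U \<in> \<U> \<and> off f U)" for n :: nat and \<U> f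
  have \<psi>: "\<psi> n \<U> f \<in> \<U> \<and> off f (\<psi> n \<U> f)" if "f \<in> \<Phi> n \<U>" for n \<U> f
  proof -
    have "\<exists>U. U \<in> \<U> \<and> off f U"
      using that by (auto simp: \<Phi>_def)
    then show ?thesis
      unfolding \<psi>_def by (rule someI_ex)
  qed
  have p_cont: "continuous_map X euclidean p"
    using p by (simp add: topspace_Cp)
  show ?thesis
  proof (rule game_transfer[where \<Phi> = \<Phi> and \<psi> = \<psi>])
    fix n \<U> assume \<U>: "\<U> \<in> Omega_covers X"
    \<comment> \<open>The difference \<open>p - p\<close> is 0 and never \<open>\<gamma> 1\<close>,
      so \<open>off p U\<close> would force \<open>U\<close> to be the whole space, which no
      omega-cover contains.\<close>
    have "p \<notin> \<Phi> n \<U>"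
    proof
      assume "p \<in> \<Phi> n \<U>"
      then obtain U where U: "U \<in> \<U>" "off p U"
        by (auto simp: \<Phi>_def)
      then have "topspace X - U = {}"
        using \<gamma>(3) by (auto simp: off_def)
      moreover have "openin X U"
        using \<U> U(1) unfolding Omega_covers_iff by blast
      ultimately have "U = topspace X"
        by (simp add: openin_subset subset_antisym)
      then show False
        using \<U> U(1) unfolding Omega_covers_iff by blast
    qed
    moreover have sub: "\<Phi> n \<U> \<subseteq> topspace (Cp X euclidean)"
      by (auto simp: \<Phi>_def)
    moreover have "\<exists>f\<in>\<Phi> n \<U>. \<forall>x\<in>F. f x - p x \<in> W"
      if F: "finite F" "F \<subseteq> topspace X" and W: "open W" "0 \<in> W" for F W
    proof -
      obtain U where U: "U \<in> \<U>" "F \<subseteq> U"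
        using \<U> F unfolding Omega_covers_iff by meson
      have "openin X U"
        using \<U> U unfolding Omega_covers_iff by blast
      then have "closedin X (topspace X - U)"
        by blast
      moreover have "compactin X F" "disjnt (topspace X - U) F"
        using F U by (auto simp: finite_imp_compactin disjnt_def)
      ultimately obtain h where h: "continuous_map X (top_of_set {0..1::real}) h"
        "h ` F \<subseteq> {0}" "h ` (topspace X - U) \<subseteq> {1}"
        by (rule Urysohn_completely_regular_closed_compact[OF zero_le_one creg])
      \<comment> \<open>Along the path, \<open>h\<close> becomes a function into the group that is 0
        on \<open>F\<close> and \<open>\<gamma> 1\<close> off \<open>U\<close>. The group may be
        non-commutative: \<open>p x\<close> is added on the right, so that \<open>f x - p x\<close>
        is exactly \<open>\<gamma> (h x)\<close>.\<close>
      define f where "f = restrict (\<lambda>x. \<gamma> (h x) + p x) (topspace X)"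
      have "continuous_map X euclidean (\<lambda>x. \<gamma> (h x))"
        using continuous_map_compose[OF h(1) \<gamma>(1)] by (simp add: o_def)
      then have "continuous_map X euclidean (\<lambda>x. \<gamma> (h x) + p x)"
        using p_cont unfolding continuous_map_atin by (auto intro!: tendsto_add)
      then have "continuous_map X euclidean f"
        by (rule continuous_map_eq) (simp add: f_def)
      then have "f \<in> topspace (Cp X euclidean)"
        by (simp add: topspace_Cp f_def)
      moreover have "off f U"
        using h(3) by (auto simp: off_def f_def image_subset_iff)
      ultimately have "f \<in> \<Phi> n \<U>"
        using U by (auto simp: \<Phi>_def)
      moreover have "\<forall>x\<in>F. f x - p x \<in> W"
        using h(2) F W \<gamma>(2) by (auto simp: f_def image_subset_iff subset_iff)
      ultimately show ?thesis
        by blast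
    qed
    ultimately show "\<Phi> n \<U> \<in> \<Lambda>"
      unfolding \<Lambda>_def accumulating_sets_def
      using in_Cp_closure_of_iff[OF p sub] by blast
  next
    show "\<psi> n \<U> f \<in> \<U>" if "f \<in> \<Phi> n \<U>" for n \<U> f
      using \<psi>[OF that] by blast
  next
    fix \<U> :: "nat \<Rightarrow> _" and B
    assume \<U>: "\<And>n. \<U> n \<in> Omega_covers X" and B: "\<And>n. B n \<subseteq> \<Phi> n (\<U> n)"
      and acc: "(\<Union>n. B n) \<in> \<Lambda>"
    let ?C = "\<Union>n. \<psi> n (\<U> n) ` B n"
    have "?C \<subseteq> (\<Union>n. \<U> n)"
      using \<psi> B by blast
    then have C: "\<forall>U\<in>?C. openin X U" "topspace X \<notin> ?C"
      using \<U> unfolding Omega_covers_iff by blast+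
    have B_sub: "(\<Union>n. B n) \<subseteq> topspace (Cp X euclidean)"
      and B_closure: "p \<in> Cp X euclidean closure_of (\<Union>n. B n)"
      using acc by (auto simp: \<Lambda>_def accumulating_sets_def)
    have "\<exists>U\<in>?C. F \<subseteq> U" if F: "finite F" "F \<subseteq> topspace X" for F
    proof -
      have "open (- {\<gamma> 1})"
        using t1 by (simp add: t1_space_closedin_singleton open_closed)
      then obtain f n where f: "f \<in> B n" "\<forall>x\<in>F. f x - p x \<in> - {\<gamma> 1}"
        using B_closure \<gamma>(3) F unfolding in_Cp_closure_of_iff[OF p B_sub] by (metis ComplI UN_E singletonD)
      then have "off f (\<psi> n (\<U> n) f)"
        using \<psi> B by blast
      then have "F \<subseteq> \<psi> n (\<U> n) f"
        using f(2) F(2) by (auto simp: off_def)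
      then show ?thesis
        using f(1) by blast
    qed
    then show "?C \<in> Omega_covers X"
      unfolding Omega_covers_iff using C by blast
  qed
qed

section \<open>Combining the transfers along the homeomorphism\<close>

text \<open>Three transfers are chained: from covers of \<open>X\<close> to accumulation at the zero
  function, along the homeomorphism to accumulation at its image, and from there to covers of
  \<open>Y\<close>. Infinity of \<open>X\<close> enters in the first, complete regularity of
  \<open>Y\<close> in the last.\<close>

lemma t_equivalent_cover_games_imp:
  fixes X :: "'a topology" and Y :: "'b topology" and a :: "'g :: topological_group_add"
  assumes "a \<noteq> 0"
    and met: "metrizable_space (euclidean :: 'g topology)"
    and arc: "arc_connected_space (euclidean :: 'g topology)"
    and "Hausdorff_space X" and "infinite (topspace X)"
    and Y: "tychonoff_space Y"
    and "t_equivalent (euclidean :: 'g topology) X Y"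
  shows "(II_wins_Gfin (Omega_covers X) (Omega_covers X) \<longrightarrow>
            II_wins_Gfin (Omega_covers Y) (Omega_covers Y)) \<and>
         (II_wins_G1 (Omega_covers X) (Omega_covers X) \<longrightarrow>
            II_wins_G1 (Omega_covers Y) (Omega_covers Y))"
proof -
  obtain \<gamma> where "embedding_map (top_of_set {0..1::real}) (euclidean :: 'g topology) \<gamma>"
    and \<gamma>: "\<gamma> 0 = 0" "\<gamma> 1 = a"
    using arc \<open>a \<noteq> 0\<close> unfolding arc_connected_space_def by (metis UNIV_I topspace_euclidean)
  then have \<gamma>_cont: "continuous_map (top_of_set {0..1::real}) (euclidean :: 'g topology) \<gamma>"
    by (meson embedding_map_def homeomorphic_imp_continuous_map continuous_map_into_fulltopology)
  obtain \<phi> k where hom: "homeomorphic_maps (Cp X (euclidean :: 'g topology)) (Cp Y (euclidean :: 'g topology)) \<phi> k"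
    using assms(7) unfolding t_equivalent_def homeomorphic_space_def by blast
  \<comment> \<open>The zero function, made undefined off the space so as to be a point of
    \<open>Cp X euclidean\<close>.\<close>
  define p :: "'a \<Rightarrow> 'g" where "p = restrict (\<lambda>_. 0) (topspace X)"
  have "continuous_map X euclidean p"
    by (rule continuous_map_eq[of _ _ "\<lambda>_. 0"]) (auto simp: p_def)
  then have p: "p \<in> topspace (Cp X euclidean)"
    by (simp add: topspace_Cp p_def)
  then have q: "\<phi> p \<in> topspace (Cp Y euclidean)"
    using hom by (auto simp: homeomorphic_maps_def continuous_map_def)
  have "t1_space X" "t1_space (euclidean :: 'g topology)"
    using assms(4) met by (auto simp: Hausdorff_imp_t1_space metrizable_imp_t1_space)
  moreover have "completely_regular_space Y" "Hausdorff_space Y"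
    using Y by (auto simp: tychonoff_space_def)
  ultimately show ?thesis
    using cover_games_imp_accumulation_games[OF met _ assms(5) p]
      accumulation_games_homeomorphic[OF hom p]
      accumulation_games_imp_cover_games[OF _ \<gamma>_cont \<gamma>(1) _ _ _ q] \<gamma>(2) \<open>a \<noteq> 0\<close>
    by blast
qed

theorem corollary4p3:
  fixes X :: "'a topology" and Y :: "'b topology"
  assumes "\<exists>g :: 'g :: topological_group_add. g \<noteq> 0"
    and "metrizable_space (euclidean :: 'g topology)"
    and "arc_connected_space (euclidean :: 'g topology)"
    and "tychonoff_space X" and "infinite (topspace X)"
    and "tychonoff_space Y" and "infinite (topspace Y)"
    and "t_equivalent (euclidean :: 'g topology) X Y"
  shows "(II_wins_Gfin (Omega_covers X) (Omega_covers X) \<longleftrightarrow>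
            II_wins_Gfin (Omega_covers Y) (Omega_covers Y)) \<and>
         (II_wins_G1 (Omega_covers X) (Omega_covers X) \<longleftrightarrow>
            II_wins_G1 (Omega_covers Y) (Omega_covers Y))"
proof -
  obtain a :: 'g where a: "a \<noteq> 0"
    using assms(1) by blast
  have sym: "t_equivalent (euclidean :: 'g topology) Y X"
    using assms(8) homeomorphic_space_sym unfolding t_equivalent_def by metis
  have Haus: "Hausdorff_space X" "Hausdorff_space Y"
    using assms(4,6) by (auto simp: tychonoff_space_def)
  show ?thesis
    using t_equivalent_cover_games_imp[OF a assms(2,3) Haus(1) assms(5,6,8)]
      t_equivalent_cover_games_imp[OF a assms(2,3) Haus(2) assms(7,4) sym]
    by blast
qed

end
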